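(* Consider the uncertain-horizon (randomly-terminated) problem on a finite directed graph with nodes $X=\{x_1,\dots,x_M\}$, termination probability $p\in(0,1)$, transition costs $K_{ij}$ and terminal costs $q_i$. Assume that (A1) $x_i\in N(x_i)$ for every $x_i\in X$; (A2) $K_{ii}=0$ for every $i$; (A3) $K_{ij}\ge0$ for all $i$ and all $j\ne i$. Then the following Dijkstra-like label-setting algorithm correctly computes the value function, i.e. upon its termination the label of every node $x_i$ equals $V(x_i)$. Algorithm: Mark all nodes $Far$ and assign to each $x_i$ the label $W_i:=q_i$. Mark as $Considered$ all nodes of $Q_l=\{x_i\mid q_i\le q_j\ \forall x_j\in N(x_i)\}$. While there are $Considered$ nodes: choose a $Considered$ node $x_j$ with the smallest label $W_j$ and mark it $Accepted$ (it is then no longer $Considered$ and its label is never changed again); then for each not-yet-$Accepted$ node $x_i$ with $x_j\in N(x_i)$, set $W_i:=\min\left(W_i,\;K_{ij}+p\,q_j+(1-p)W_j\right)$ and, if $x_i$ is $Far$, mark it $Considered$.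
   Context: $N(x_i)\subset X$ is the set of nodes to which a direct transition from $x_i$ is possible. A transition from $x_i$ to $x_j\in N(x_i)$ has real cost $K_{ij}=K(x_i,x_j)$ (and $K_{ij}=+\infty$ if $x_j\notin N(x_i)$); $q_i=q(x_i)\in\mathbb{R}$ is the terminal cost at $x_i$. A path is an infinite sequence $\mathbf{y}=(y_0,y_1,\dots)$ with $y_{k+1}\in N(y_k)$ for all $k\ge0$. The process terminates with probability $p$ after each transition. With $Cost(y_0,\dots,y_t)=\sum_{k=0}^{t-1}K(y_k,y_{k+1})+q(y_t)$, the expected cost of a path is $J(\mathbf{y})=\sum_{t=1}^\infty (1-p)^{t-1}p\,Cost(y_0,\dots,y_t)$, and the value function is $V(x)=\min J(\mathbf{y})$ over all paths with $y_0=x$. *)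

theory Defs
  imports Complex_Main
begin

text \<open>
  The nodes are the elements of a finite type. \<open>N x\<close> is the set of direct successors of \<open>x\<close>.
  The cost \<open>K x y\<close> is a real number meaningful only for \<open>y \<in> N x\<close>; all other transitions, whose
  cost is \<open>+\<infinity>\<close> by convention, occur neither in paths nor in the algorithm, so the value
  of \<open>K\<close> there is irrelevant.
\<close>

definition paths :: "('a \<Rightarrow> 'a set) \<Rightarrow> 'a \<Rightarrow> (nat \<Rightarrow> 'a) set" where
  "paths N x = {y. y 0 = x \<and> (\<forall>k. y (Suc k) \<in> N (y k))}"

definition Cost :: "('a \<Rightarrow> 'a \<Rightarrow> real) \<Rightarrow> ('a \<Rightarrow> real) \<Rightarrow> (nat \<Rightarrow> 'a) \<Rightarrow> nat \<Rightarrow> real" where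
  "Cost K q y t = (\<Sum>k<t. K (y k) (y (Suc k))) + q (y t)"

text \<open>
  The summation index is shifted by one (\<open>t\<close> here is \<open>t - 1\<close> in the usual formula). Over a finite
  set of nodes \<open>Cost\<close> grows at most linearly in \<open>t\<close>, so for \<open>0 < p < 1\<close> the series converges
  absolutely for every path.
\<close>

definition expected_cost ::
    "('a \<Rightarrow> 'a \<Rightarrow> real) \<Rightarrow> ('a \<Rightarrow> real) \<Rightarrow> real \<Rightarrow> (nat \<Rightarrow> 'a) \<Rightarrow> real" where
  "expected_cost K q p y = (\<Sum>t. (1 - p) ^ t * p * Cost K q y (Suc t))"

text \<open>
  The value function is a minimum, not merely an infimum: the \<open>LEAST\<close> below is specified only if
  the minimum over all paths is attained.
\<close>

definition value_fun ::
    "('a \<Rightarrow> 'a set) \<Rightarrow> ('a \<Rightarrow> 'a \<Rightarrow> real) \<Rightarrow> ('a \<Rightarrow> real) \<Rightarrow> real \<Rightarrow> 'a \<Rightarrow> real" where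
  "value_fun N K q p x = (LEAST v. v \<in> expected_cost K q p ` paths N x)"

datatype mark = Far | Considered | Accepted

record 'a alg_state =
  mark :: "'a \<Rightarrow> mark"
  label :: "'a \<Rightarrow> real"

definition local_minima :: "('a \<Rightarrow> 'a set) \<Rightarrow> ('a \<Rightarrow> real) \<Rightarrow> 'a set" where
  "local_minima N q = {i. \<forall>j\<in>N i. q i \<le> q j}"

definition init_state :: "('a \<Rightarrow> 'a set) \<Rightarrow> ('a \<Rightarrow> real) \<Rightarrow> 'a alg_state" where
  "init_state N q =
     \<lparr> mark = (\<lambda>i. if i \<in> local_minima N q then Considered else Far), label = q \<rparr>"

definition accept ::
    "('a \<Rightarrow> 'a set) \<Rightarrow> ('a \<Rightarrow> 'a \<Rightarrow> real) \<Rightarrow> ('a \<Rightarrow> real) \<Rightarrow> real \<Rightarrow> 'a \<Rightarrow> 'a alg_state \<Rightarrow> 'a alg_state"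
  where
  "accept N K q p j s =
     \<lparr> mark = (\<lambda>i. if i = j then Accepted
                   else if mark s i = Far \<and> j \<in> N i then Considered
                   else mark s i),
       label = (\<lambda>i. if i \<noteq> j \<and> mark s i \<noteq> Accepted \<and> j \<in> N i
                    then min (label s i) (K i j + p * q j + (1 - p) * label s j)
                    else label s i) \<rparr>"

text \<open>
  One iteration of the loop. It is a relation because ties between smallest labels may be broken
  arbitrarily.
\<close>

inductive alg_step ::
    "('a \<Rightarrow> 'a set) \<Rightarrow> ('a \<Rightarrow> 'a \<Rightarrow> real) \<Rightarrow> ('a \<Rightarrow> real) \<Rightarrow> real \<Rightarrow> 'a alg_state \<Rightarrow> 'a alg_state \<Rightarrow> bool"
  for N :: "'a \<Rightarrow> 'a set" and K :: "'a \<Rightarrow> 'a \<Rightarrow> real" and q :: "'a \<Rightarrow> real" and p :: real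
  where
  "mark s j = Considered \<Longrightarrow> (\<forall>i. mark s i = Considered \<longrightarrow> label s j \<le> label s i) \<Longrightarrow>
   alg_step N K q p s (accept N K q p j s)"

definition finished :: "'a alg_state \<Rightarrow> bool" where
  "finished s \<longleftrightarrow> (\<forall>i. mark s i \<noteq> Considered)"

lemma not_finished_iff_step:
  fixes s :: "'a::finite alg_state"
  shows "\<not> finished s \<longleftrightarrow> (\<exists>s'. alg_step N K q p s s')"
proof
  assume "\<not> finished s"
  then have "{i. mark s i = Considered} \<noteq> {}" by (auto simp: finished_def)
  then obtain j where "is_arg_min (label s) (\<lambda>i. i \<in> {i. mark s i = Considered}) j"
    using ex_is_arg_min_if_finite[of "{i. mark s i = Considered}" "label s"] by auto
  then have "mark s j = Considered" "\<forall>i. mark s i = Considered \<longrightarrow> label s j \<le> label s i"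
    by (auto simp: is_arg_min_linorder)
  then show "\<exists>s'. alg_step N K q p s s'" by (blast intro: alg_step.intros)
next
  assume "\<exists>s'. alg_step N K q p s s'"
  then show "\<not> finished s" by (auto simp: finished_def elim: alg_step.cases)
qed

end

(* Proof idea: let V x be the infimum of the expected costs over all paths from x. Every label is
   the expected cost of some path, so labels never drop below V. Conversely, if V x < q x, then an
   optimal first move goes to some other node n with V x >= K x n + p q n + (1 - p) V n, and as
   V n <= q n this gives V n <= V x, strictly unless V n = q n. Hence among the nodes whose label is
   too large, one with minimal V has a successor n whose label is already exact, and n cannot
   have been accepted. If n is far, its label is still q n, and descending in q from n leads to a
   considered node whose label is at most q n. So a considered node of smallest label has the exact
   label. At the end every label is exact; in particular the infimum is attained. *)
theory Submission
  imports Defs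
begin

section \<open>Paths and the growth of their costs\<close>

lemma paths_imp_shift:
  assumes "y \<in> paths N x"
  shows "y 1 \<in> N x" and "(\<lambda>n. y (Suc n)) \<in> paths N (y 1)"
  using assms by (auto simp: paths_def)

lemma const_in_paths: "x \<in> N x \<Longrightarrow> (\<lambda>_. x) \<in> paths N x"
  by (simp add: paths_def)

lemma Cons_in_paths:
  assumes "y \<in> paths N j" and "j \<in> N i"
  shows "case_nat i y \<in> paths N i"
  using assms by (auto simp: paths_def split: nat.split)

lemma Cost_Suc: "Cost K q y (Suc t) = K (y 0) (y 1) + Cost K q (\<lambda>n. y (Suc n)) t"
  unfolding Cost_def by (subst sum.lessThan_Suc_shift) simp

text \<open>Growth is at most linear in the number of transitions, with a constant independent of
  the path, so the geometric weights make the cost series summable.\<close>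

lemma abs_Cost_bound:
  fixes K :: "'a::finite \<Rightarrow> 'a \<Rightarrow> real"
  obtains C where "\<And>y t. \<bar>Cost K q y (Suc t)\<bar> \<le> of_nat (Suc t) * C"
proof -
  define A where "A = Max (range (\<lambda>(i, j). \<bar>K i j\<bar>))"
  define B where "B = Max (range (\<lambda>i. \<bar>q i\<bar>))"
  have A: "\<bar>K i j\<bar> \<le> A" for i j
    unfolding A_def by (rule Max_ge) (auto intro!: range_eqI[of _ _ "(i, j)"])
  have B: "\<bar>q i\<bar> \<le> B" for i
    unfolding B_def by (rule Max_ge) auto
  have "\<bar>Cost K q y (Suc t)\<bar> \<le> of_nat (Suc t) * (A + B)" for y t
  proof -
    have "\<bar>\<Sum>k<Suc t. K (y k) (y (Suc k))\<bar> \<le> (\<Sum>k<Suc t. \<bar>K (y k) (y (Suc k))\<bar>)"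
      by (rule sum_abs)
    also have "\<dots> \<le> of_nat (card {..<Suc t}) * A"
      by (rule sum_bounded_above) (rule A)
    finally have 1: "\<bar>\<Sum>k<Suc t. K (y k) (y (Suc k))\<bar> \<le> of_nat (Suc t) * A"
      by simp
    \<comment> \<open>Here \<open>undefined\<close> is just an arbitrary node.\<close>
    have "0 \<le> B"
      using B[of undefined] by linarith
    then have "B \<le> of_nat (Suc t) * B"
      using mult_right_mono[of 1 "of_nat (Suc t)" B] by simp
    then have 2: "\<bar>q (y (Suc t))\<bar> \<le> of_nat (Suc t) * B"
      using B order_trans by blast
    show ?thesis
      unfolding Cost_def distrib_left using 1 2 by linarith
  qed
  then show thesis by (rule that)
qed

section \<open>Termination: the set of nodes not yet accepted shrinks strictly\<close>

lemma not_Accepted_accept_psubset: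
  assumes "mark s j = Considered"
  shows "{i. mark (accept N K q p j s) i \<noteq> Accepted} \<subset> {i. mark s i \<noteq> Accepted}"
proof
  show "{i. mark (accept N K q p j s) i \<noteq> Accepted} \<subseteq> {i. mark s i \<noteq> Accepted}"
    by (auto simp: accept_def)
  show "{i. mark (accept N K q p j s) i \<noteq> Accepted} \<noteq> {i. mark s i \<noteq> Accepted}"
    using assms by (intro notI, drule_tac eqset_imp_iff[of _ _ j]) (simp add: accept_def)
qed

lemma alg_step_no_infinite_run:
  fixes s :: "nat \<Rightarrow> 'a::finite alg_state"
  assumes run: "\<And>n. alg_step N K q p (s n) (s (Suc n))"
  shows False
proof -
  let ?m = "\<lambda>n. card {i. mark (s n) i \<noteq> Accepted}"
  have "?m (Suc n) < ?m n" for n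
    using run[of n] by cases (auto intro!: psubset_card_mono dest!: not_Accepted_accept_psubset)
  then have "(s (Suc n), s n) \<in> measure (\<lambda>s. card {i. mark s i \<noteq> Accepted})" for n
    by simp
  then show False
    using wf_measure wf_iff_no_infinite_down_chain by metis
qed

section \<open>Expected costs: convergence and recursion\<close>

locale terminating_graph =
  fixes N :: "'a::finite \<Rightarrow> 'a set"
    and K :: "'a \<Rightarrow> 'a \<Rightarrow> real"
    and q :: "'a \<Rightarrow> real"
    and p :: real
  assumes p_pos: "0 < p" and p_less_1: "p < 1"
    and self_loop: "i \<in> N i"
    and K_self [simp]: "K i i = 0"
    and K_nonneg: "j \<in> N i \<Longrightarrow> 0 \<le> K i j"
begin

abbreviation "J \<equiv> expected_cost K q p"

text \<open>An infimum can be used before the minimum is known to be attained, unlike the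
  \<open>LEAST\<close> in \<open>value_fun\<close>.\<close>

definition V :: "'a \<Rightarrow> real" where
  "V x = (INF y\<in>paths N x. J y)"

lemma summable_expected_cost: "summable (\<lambda>t. (1 - p) ^ t * p * Cost K q y (Suc t))"
proof -
  obtain C where C: "\<And>y t. \<bar>Cost K q y (Suc t)\<bar> \<le> of_nat (Suc t) * C"
    using abs_Cost_bound[of K q] by blast
  \<comment> \<open>The dominating series is the derivative of the geometric series.\<close>
  have "summable (\<lambda>t. of_nat (Suc t) * (1 - p) ^ t * (p * C))"
    by (intro summable_mult2 sums_summable[OF geometric_deriv_sums]) (use p_pos p_less_1 in auto)
  moreover have "norm ((1 - p) ^ t * p * Cost K q y (Suc t))
      \<le> of_nat (Suc t) * (1 - p) ^ t * (p * C)" for t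
  proof -
    have "norm ((1 - p) ^ t * p * Cost K q y (Suc t)) = (1 - p) ^ t * p * \<bar>Cost K q y (Suc t)\<bar>"
      using p_pos p_less_1 by (simp add: abs_mult)
    also have "\<dots> \<le> (1 - p) ^ t * p * (of_nat (Suc t) * C)"
      using C p_pos p_less_1 by (intro mult_left_mono) auto
    finally show ?thesis by (simp only: mult_ac)
  qed
  ultimately show ?thesis
    by (rule summable_comparison_test'[where N = 0])
qed

lemma sums_weights: "(\<lambda>t. (1 - p) ^ t * p * c) sums c"
proof -
  have "(\<lambda>t. (1 - p) ^ t * (p * c)) sums (1 / (1 - (1 - p)) * (p * c))"
    by (intro sums_mult2 geometric_sums) (use p_pos p_less_1 in auto)
  then show ?thesis
    using p_pos by (simp add: mult.assoc)
qed

text \<open>Condition on the first transition: its cost is always paid; then the process stops with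
  probability \<open>p\<close> or continues along the shifted path.\<close>

lemma expected_cost_rec:
  "J y = K (y 0) (y 1) + p * q (y 1) + (1 - p) * J (\<lambda>n. y (Suc n))"
proof -
  let ?z = "\<lambda>n. y (Suc n)"
  \<comment> \<open>With \<open>t\<close> in place of \<open>Suc t\<close>, the term
    \<open>?g 0\<close> is \<open>p * q (y 1)\<close>, the contribution of stopping after the first
    transition.\<close>
  let ?g = "\<lambda>t. (1 - p) ^ t * p * Cost K q ?z t"
  have "(\<lambda>t. (1 - p) * ((1 - p) ^ t * p * Cost K q ?z (Suc t))) sums ((1 - p) * J ?z)"
    unfolding expected_cost_def by (intro sums_mult summable_sums summable_expected_cost)
  then have "(\<lambda>t. ?g (Suc t)) sums ((1 - p) * J ?z)"
    by (simp add: mult_ac)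
  then have "?g sums ((1 - p) * J ?z + p * q (y 1))"
    by (subst (asm) sums_Suc_iff) (simp add: Cost_def)
  from sums_add[OF sums_weights[of "K (y 0) (y 1)"] this]
  have "(\<lambda>t. (1 - p) ^ t * p * Cost K q y (Suc t)) sums
      (K (y 0) (y 1) + ((1 - p) * J ?z + p * q (y 1)))"
    by (simp only: Cost_Suc distrib_left)
  then show ?thesis
    unfolding expected_cost_def[of K q p y] by (simp add: sums_iff)
qed

text \<open>Since the loop at \<open>x\<close> is free, the recursion is a linear equation for the
  cost of staying there.\<close>

lemma expected_cost_const: "J (\<lambda>_. x) = q x"
proof -
  have "J (\<lambda>_. x) = p * q x + (1 - p) * J (\<lambda>_. x)"
    by (subst expected_cost_rec) simp
  then have "p * J (\<lambda>_. x) = p * q x"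
    by algebra
  then show ?thesis
    using p_pos by simp
qed

lemma expected_cost_Cons:
  assumes "y \<in> paths N j"
  shows "J (case_nat i y) = K i j + p * q j + (1 - p) * J y"
  using assms expected_cost_rec[of "case_nat i y"] by (simp add: paths_def)

lemma expected_cost_ge_Min:
  assumes "y \<in> paths N x"
  shows "Min (range q) \<le> J y"
proof -
  have "Min (range q) \<le> Cost K q y (Suc t)" for t
  proof -
    have "0 \<le> (\<Sum>k<Suc t. K (y k) (y (Suc k)))"
      using assms by (intro sum_nonneg K_nonneg) (auto simp: paths_def)
    moreover have "Min (range q) \<le> q (y (Suc t))" by simp
    ultimately show ?thesis unfolding Cost_def by linarith
  qed
  then have "(1 - p) ^ t * p * Min (range q) \<le> (1 - p) ^ t * p * Cost K q y (Suc t)" for t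
    using p_pos p_less_1 by (intro mult_left_mono) auto
  then show ?thesis
    unfolding expected_cost_def
    by (rule sums_le[OF _ sums_weights summable_sums[OF summable_expected_cost]])
qed

section \<open>Bellman inequality and causality for the infimum\<close>

lemma V_le_expected_cost: "y \<in> paths N x \<Longrightarrow> V x \<le> J y"
  unfolding V_def by (rule cINF_lower) (auto intro!: bdd_belowI2 expected_cost_ge_Min)

lemma V_le_q: "V x \<le> q x"
  using V_le_expected_cost[OF const_in_paths[of x N]] self_loop by (simp add: expected_cost_const)

text \<open>There are finitely many first moves, so one minimizes the one-step bound; this bound
  lies below the cost of every path, hence below the infimum.\<close>

lemma V_ge_best_successor:
  obtains j where "j \<in> N x" and "K x j + p * q j + (1 - p) * V j \<le> V x"
proof -
  define f where "f j = K x j + p * q j + (1 - p) * V j" for j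
  have "finite (f ` N x)" and "f ` N x \<noteq> {}"
    using self_loop by auto
  then have "Min (f ` N x) \<in> f ` N x"
    by (rule Min_in)
  then obtain j where j: "j \<in> N x" "Min (f ` N x) = f j"
    by auto
  have "f j \<le> J y" if y: "y \<in> paths N x" for y
  proof -
    have "f j \<le> f (y 1)"
      unfolding j(2)[symmetric] using paths_imp_shift(1)[OF y] by (intro Min_le) auto
    also have "\<dots> \<le> K x (y 1) + p * q (y 1) + (1 - p) * J (\<lambda>n. y (Suc n))"
      unfolding f_def using V_le_expected_cost[OF paths_imp_shift(2)[OF y]] p_less_1
      by (intro add_left_mono mult_left_mono) auto
    also have "\<dots> = J y"
      using y by (simp add: expected_cost_rec[of y] paths_def)
    finally show ?thesis .
  qed
  then have "f j \<le> V x"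
    unfolding V_def using const_in_paths[of _ N, OF self_loop] by (intro cINF_greatest) auto
  with j(1) show thesis
    unfolding f_def by (rule that)
qed

lemma V_causal:
  assumes "V x < q x"
  obtains n where "n \<in> N x" and "K x n + p * q n + (1 - p) * V n \<le> V x"
    and "V n \<le> V x" and "V n < V x \<or> V n = q n"
proof -
  obtain n where n: "n \<in> N x" "K x n + p * q n + (1 - p) * V n \<le> V x"
    by (rule V_ge_best_successor)
  \<comment> \<open>Drop the nonnegative transition cost and regroup; the gap
    \<open>q n - V n\<close> is nonnegative, and \<open>p > 0\<close> makes its term strict when
    \<open>V n < q n\<close>.\<close>
  then have le: "V n + p * (q n - V n) \<le> V x"
    using K_nonneg[of n x] by (simp add: algebra_simps)
  have 0: "0 \<le> p * (q n - V n)" "V n < q n \<Longrightarrow> 0 < p * (q n - V n)"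
    using p_pos V_le_q[of n] by auto
  have "V n \<le> V x" "V n < V x \<or> V n = q n"
    using le 0 V_le_q[of n] by linarith+
  with n show thesis by (rule that)
qed

section \<open>The loop invariant and its preservation\<close>

definition invar :: "'a alg_state \<Rightarrow> bool" where
  "invar s \<longleftrightarrow>
     (\<forall>i. \<exists>y\<in>paths N i. J y = label s i) \<and>
     (\<forall>i. label s i \<le> q i) \<and>
     (\<forall>i. mark s i = Far \<longrightarrow> label s i = q i) \<and>
     (\<forall>i\<in>local_minima N q. mark s i \<noteq> Far) \<and>
     (\<forall>i. mark s i = Accepted \<longrightarrow> label s i = V i) \<and>
     (\<forall>i. \<forall>j\<in>N i. mark s j = Accepted \<longrightarrow>
        mark s i \<noteq> Far \<and> label s i \<le> K i j + p * q j + (1 - p) * label s j)"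

lemma invar_init: "invar (init_state N q)"
proof -
  have "\<exists>y\<in>paths N i. J y = q i" for i
    using const_in_paths[of i N, OF self_loop] expected_cost_const[of i] by blast
  then show ?thesis
    by (simp add: invar_def init_state_def)
qed

lemma invar_V_le_label: "invar s \<Longrightarrow> V i \<le> label s i"
  unfolding invar_def using V_le_expected_cost by metis

text \<open>A far node \<open>g\<close> of least \<open>q\<close> is no local minimum, so it has a
  successor with smaller \<open>q\<close>. That successor is not far by the choice of
  \<open>g\<close>, nor accepted, since acceptance would have made \<open>g\<close>
  considered.\<close>

lemma invar_Far_imp_Considered:
  assumes "invar s" and "mark s f = Far"
  obtains c where "mark s c = Considered" and "q c \<le> q f"
proof -
  obtain g where g: "is_arg_min q (\<lambda>i. mark s i = Far) g"
    using ex_is_arg_min_if_finite[of "{i. mark s i = Far}" q] assms(2) by auto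
  then have "g \<notin> local_minima N q"
    using assms(1) by (auto simp: invar_def is_arg_min_linorder)
  then obtain c where c: "c \<in> N g" "q c < q g"
    by (auto simp: local_minima_def not_le)
  have "mark s c \<noteq> Far"
    using g c by (auto simp: is_arg_min_linorder)
  moreover have "mark s c \<noteq> Accepted"
    using assms(1) g c by (auto simp: invar_def is_arg_min_linorder)
  ultimately have "mark s c = Considered"
    by (cases "mark s c") auto
  moreover have "q c \<le> q f"
    using g c assms(2) by (fastforce simp: is_arg_min_linorder)
  ultimately show thesis by (rule that)
qed

lemma invar_smallest_label_exact:
  assumes inv: "invar s" and "mark s j = Considered"
    and smallest: "\<And>i. mark s i = Considered \<Longrightarrow> label s j \<le> label s i"
  shows "label s j = V j"
proof (rule ccontr)
  assume "label s j \<noteq> V j"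
  then have j: "V j < label s j"
    using invar_V_le_label[OF inv, of j] by simp
  then obtain u where u: "is_arg_min V (\<lambda>i. V i < label s i) u"
    using ex_is_arg_min_if_finite[of "{i. V i < label s i}" V] by auto
  then have u1: "V u < label s u" and u2: "\<And>i. V i < label s i \<Longrightarrow> V u \<le> V i"
    by (auto simp: is_arg_min_linorder)
  have q: "label s i \<le> q i" for i
    using inv by (simp add: invar_def)
  have "V u < q u"
    using u1 q by (rule less_le_trans)
  then obtain n where n: "n \<in> N u" "K u n + p * q n + (1 - p) * V n \<le> V u"
    "V n \<le> V u" "V n < V u \<or> V n = q n"
    by (rule V_causal)
  \<comment> \<open>If \<open>V n < V u\<close>, minimality of \<open>u\<close> excludes a label
    that is too large; if \<open>V n = q n\<close>, the label is squeezed between the two.\<close>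
  have exact: "label s n = V n"
    using n(4) u2[of n] q[of n] invar_V_le_label[OF inv, of n] by linarith
  have "V n < label s j"
    using n(3) u2[OF j] j by linarith
  show False
  proof (cases "mark s n")
    case Far
    then have "q n = V n"
      using inv exact by (simp add: invar_def)
    obtain c where "mark s c = Considered" "q c \<le> q n"
      using inv Far by (rule invar_Far_imp_Considered)
    then show False
      using smallest[of c] q[of c] \<open>q n = V n\<close> \<open>V n < label s j\<close> by linarith
  next
    case Considered
    then show False
      using smallest[of n] exact \<open>V n < label s j\<close> by linarith
  next
    case Accepted
    \<comment> \<open>The update made when \<open>n\<close> was accepted already brought the label
      of \<open>u\<close> down to \<open>V u\<close>.\<close>
    then have "label s u \<le> K u n + p * q n + (1 - p) * V n"
      using inv n(1) exact by (auto simp: invar_def)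
    then show False
      using n(2) u1 by linarith
  qed
qed

lemma invar_accept:
  assumes inv: "invar s" and j: "mark s j = Considered"
    and smallest: "\<And>i. mark s i = Considered \<Longrightarrow> label s j \<le> label s i"
  shows "invar (accept N K q p j s)"
proof -
  let ?s' = "accept N K q p j s"
  have exact: "label s j = V j"
    using assms by (rule invar_smallest_label_exact)
  have att: "\<exists>y\<in>paths N i. J y = label s i" for i
    using inv by (simp add: invar_def)
  have acc: "label s i = V i" if "mark s i = Accepted" for i
    using inv that by (simp add: invar_def)
  have new: "\<exists>y\<in>paths N i. J y = K i k + p * q k + (1 - p) * label s k" if "k \<in> N i" for i k
    using att[of k] that Cons_in_paths expected_cost_Cons by metis
  have bellman: "V i \<le> K i k + p * q k + (1 - p) * label s k" if "k \<in> N i" for i k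
    using new[OF that] V_le_expected_cost by metis
  have same: "label ?s' i = label s i" if "mark s i = Accepted \<or> i = j" for i
    using that by (auto simp: accept_def)
  have le: "label ?s' i \<le> label s i" for i
    by (auto simp: accept_def)
  have mark: "mark ?s' i = Accepted \<longleftrightarrow> mark s i = Accepted \<or> i = j" for i
    by (auto simp: accept_def)
  have "\<exists>y\<in>paths N i. J y = label ?s' i" for i
    using att[of i] new[of j i] by (auto simp: accept_def min_def)
  moreover have "label ?s' i \<le> q i" for i
    using le[of i] inv unfolding invar_def by (meson order_trans)
  moreover have "label ?s' i = q i" if "mark ?s' i = Far" for i
    using that inv by (auto simp: accept_def invar_def split: if_splits)
  moreover have "mark ?s' i \<noteq> Far" if "i \<in> local_minima N q" for i
    using that inv by (auto simp: accept_def invar_def)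
  moreover have "label ?s' i = V i" if "mark ?s' i = Accepted" for i
    using that same acc exact mark by metis
  moreover have "mark ?s' i \<noteq> Far" if "k \<in> N i" "mark ?s' k = Accepted" for i k
    using that inv by (auto simp: accept_def invar_def split: if_splits)
  moreover have "label ?s' i \<le> K i k + p * q k + (1 - p) * label ?s' k"
    if k: "k \<in> N i" "mark ?s' k = Accepted" for i k
  proof -
    have k': "label ?s' k = label s k"
      using k mark same by blast
    consider "mark s i = Accepted \<or> i = j" | "k = j" "mark s i \<noteq> Accepted" "i \<noteq> j"
      | "mark s k = Accepted"
      using k mark by blast
    then show ?thesis
    proof cases
      \<comment> \<open>The label of \<open>i\<close> is frozen and receives no update from
        \<open>k\<close>, but it equals \<open>V i\<close>, which is at most the cost of any path
        starting with a move to \<open>k\<close>.\<close>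
      case 1
      then have "label ?s' i = V i"
        using same acc exact by metis
      then show ?thesis
        using bellman[OF k(1)] k' by simp
    next
      case 2
      then show ?thesis
        using k by (simp add: accept_def)
    next
      case 3
      then have "label s i \<le> K i k + p * q k + (1 - p) * label s k"
        using inv k(1) by (auto simp: invar_def)
      then show ?thesis
        using le[of i] k' by simp
    qed
  qed
  ultimately show ?thesis
    unfolding invar_def by blast
qed

lemma invar_run:
  assumes "(alg_step N K q p)\<^sup>*\<^sup>* (init_state N q) s"
  shows "invar s"
  using assms
proof (induction rule: rtranclp_induct)
  case base
  show ?case by (rule invar_init)
next
  case (step s s')
  from step.hyps(2) show ?case
    by cases (use step.IH in \<open>auto intro: invar_accept\<close>)
qed

text \<open>A remaining far node would force a considered one, so every node is accepted. The path
  realizing each label shows that the minimum is attained.\<close>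

lemma finished_label_eq_value_fun:
  assumes inv: "invar s" and fin: "finished s"
  shows "label s x = value_fun N K q p x"
proof -
  have "mark s x \<noteq> Considered" for x
    using fin by (simp add: finished_def)
  then have "mark s x = Accepted"
    using invar_Far_imp_Considered[OF inv] by (metis mark.exhaust)
  then have V: "label s x = V x"
    using inv by (simp add: invar_def)
  have "label s x \<in> J ` paths N x"
    using inv by (auto simp: invar_def image_iff) metis
  moreover have "label s x \<le> v" if "v \<in> J ` paths N x" for v
    using that V V_le_expected_cost by auto
  ultimately have "(LEAST v. v \<in> J ` paths N x) = label s x"
    by (rule Least_equality)
  then show ?thesis
    by (simp add: value_fun_def)
qed

end

theorem mainTheorem3:
  fixes N :: "'a::finite \<Rightarrow> 'a set"
    and K :: "'a \<Rightarrow> 'a \<Rightarrow> real"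
    and q :: "'a \<Rightarrow> real"
    and p :: real
  assumes "0 < p" and "p < 1"
    and A1: "\<forall>i. i \<in> N i"
    and A2: "\<forall>i. K i i = 0"
    and A3: "\<forall>i. \<forall>j\<in>N i. j \<noteq> i \<longrightarrow> K i j \<ge> 0"
  shows "(\<nexists>s. s 0 = init_state N q \<and> (\<forall>n. alg_step N K q p (s n) (s (Suc n)))) \<and>
         (\<forall>s. (alg_step N K q p)\<^sup>*\<^sup>* (init_state N q) s \<and> finished s \<longrightarrow>
              (\<forall>x. label s x = value_fun N K q p x))"
proof -
  interpret terminating_graph N K q p
  proof
    \<comment> \<open>\<open>A3\<close> covers \<open>j\<close> different from \<open>i\<close>, and
      \<open>A2\<close> supplies the diagonal.\<close>
    show "0 \<le> K i j" if "j \<in> N i" for i j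
      using A2 A3 that by (cases "j = i") auto
  qed (use assms in auto)
  show ?thesis
    using alg_step_no_infinite_run invar_run finished_label_eq_value_fun by blast
qed

end
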